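(* Let $R$ be a commutative ring with identity. If $R$ satisfies the $\ast$-property, then $R$ is zero-dimensional.
   Context: A ring $R$ is said to satisfy the $\ast$-property if for every family $\{I_\alpha\}_{\alpha\in S}$ of ideals of $R$ (with $S$ an arbitrary index set) there exists a finite subset $S'\subseteq S$ such that $\sqrt{\bigcap_{\alpha\in S} I_\alpha}=\bigcap_{\alpha\in S'}\sqrt{I_\alpha}$, where $\sqrt{I}$ denotes the radical of the ideal $I$. Zero-dimensional is meant in the sense of Krull dimension, i.e. every prime ideal of $R$ is maximal. *)

theory Defs
  imports "HOL-Algebra.Ideal"
begin

definition radical :: "('a, 'b) ring_scheme \<Rightarrow> 'a set \<Rightarrow> 'a set" where
  "radical R I = {x \<in> carrier R. \<exists>n::nat. n \<ge> 1 \<and> x [^]\<^bsub>R\<^esub> n \<in> I}"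

text \<open>
  Intersections are taken inside \<open>carrier R\<close>, so that the intersection of the empty family is the
  whole ring. HOL cannot quantify over index types inside a definition; the index sets range over
  subsets of \<^typ>\<open>'a set\<close>, which is large enough to index every set of ideals of \<open>R\<close> by itself.
  Lemma \<open>star_propertyD\<close> below recovers the property for families over any index type.
\<close>

definition star_property :: "('a, 'b) ring_scheme \<Rightarrow> bool" where
  "star_property R \<longleftrightarrow>
     (\<forall>(S :: 'a set set) (I :: 'a set \<Rightarrow> 'a set).
        (\<forall>\<alpha>\<in>S. ideal (I \<alpha>) R) \<longrightarrow>
        (\<exists>S'. S' \<subseteq> S \<and> finite S' \<and>
           radical R (carrier R \<inter> (\<Inter>\<alpha>\<in>S. I \<alpha>)) =
           carrier R \<inter> (\<Inter>\<alpha>\<in>S'. radical R (I \<alpha>))))"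

definition zero_dimensional :: "('a, 'b) ring_scheme \<Rightarrow> bool" where
  "zero_dimensional R \<longleftrightarrow> (\<forall>P. primeideal P R \<longrightarrow> maximalideal P R)"

lemma star_propertyD:
  fixes R :: "('a, 'b) ring_scheme" and S :: "'i set" and I :: "'i \<Rightarrow> 'a set"
  assumes "star_property R" and "\<And>\<alpha>. \<alpha> \<in> S \<Longrightarrow> ideal (I \<alpha>) R"
  shows "\<exists>S'. S' \<subseteq> S \<and> finite S' \<and>
           radical R (carrier R \<inter> (\<Inter>\<alpha>\<in>S. I \<alpha>)) =
           carrier R \<inter> (\<Inter>\<alpha>\<in>S'. radical R (I \<alpha>))"
proof -
  have "\<forall>J\<in>I ` S. ideal (id J) R"
    using assms(2) by auto
  with assms(1)[unfolded star_property_def, THEN spec, THEN spec, of "I ` S" id]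
  obtain T where T: "T \<subseteq> I ` S" "finite T"
    "radical R (carrier R \<inter> (\<Inter>J\<in>I ` S. id J)) = carrier R \<inter> (\<Inter>J\<in>T. radical R (id J))"
    by (elim impE exE conjE)
  obtain S' where "S' \<subseteq> S" "finite S'" "T = I ` S'"
    using finite_subset_image[OF T(2,1)] by blast
  then show ?thesis
    using T(3) by auto
qed

end

theory Submission
  imports Defs
begin

text \<open>
  The radicals of the principal ideals \<open>(a\<^sup>n)\<close>, \<open>n \<ge> 1\<close>, all contain \<open>a\<close>, so by the
  \<open>\<ast>\<close>-property some power \<open>a\<^sup>k\<close> lies in all of these ideals, in particular \<open>a\<^sup>k = r a\<^sup>k\<^sup>+\<^sup>1\<close>.
  If \<open>P\<close> is a prime ideal, \<open>J \<supseteq> P\<close> an ideal and \<open>a \<in> J - P\<close>, then \<open>a\<^sup>k (1 - r a) = 0\<close> lies in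
  \<open>P\<close>, whence \<open>1 - r a \<in> P \<subseteq> J\<close> and \<open>1 \<in> J\<close>.
\<close>

lemma star_property_power_eq:
  fixes R :: "('a, 'b) ring_scheme" (structure)
  assumes "cring R" and "star_property R" and a: "a \<in> carrier R"
  obtains k :: nat and r where "r \<in> carrier R" "a [^] k = r \<otimes> a [^] Suc k"
proof -
  interpret cring R by fact
  \<comment> \<open>The shift makes the member with index \<open>k\<close> generated by
    \<open>a [^] Suc k\<close>, so \<open>a [^] k\<close> lying in \<open>?I k\<close> is the
    desired equation.\<close>
  let ?I = "\<lambda>n::nat. PIdl (a [^] Suc n)"
  have pow: "a [^] Suc n \<in> carrier R" for n :: nat
    using a by (rule nat_pow_closed)
  obtain S where S: "radical R (carrier R \<inter> (\<Inter>n\<in>UNIV. ?I n)) =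
      carrier R \<inter> (\<Inter>n\<in>S. radical R (?I n))"
    using star_propertyD[OF assms(2), of UNIV ?I] cgenideal_ideal[OF pow] by blast
  have "a \<in> radical R (?I n)" for n
    unfolding radical_def using a cgenideal_self[OF pow[of n]]
    by (auto intro!: exI[of _ "Suc n"])
  then have "a \<in> radical R (carrier R \<inter> (\<Inter>n\<in>UNIV. ?I n))"
    unfolding S using a by blast
  then obtain k :: nat where "a [^] k \<in> carrier R \<inter> (\<Inter>n\<in>UNIV. ?I n)"
    unfolding radical_def by blast
  then have "a [^] k \<in> ?I k"
    by blast
  then show thesis
    unfolding cgenideal_def using that by blast
qed

text \<open>Primeness peels off one factor at a time; the case \<open>n = 0\<close> is vacuous, as a
  proper ideal omits \<open>\<one>\<close>.\<close>

lemma (in primeideal) nat_pow_mem_imp_mem: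
  assumes a: "a \<in> carrier R" and "a [^] (n::nat) \<in> I"
  shows "a \<in> I"
  using assms(2)
proof (induction n)
  case 0
  then show ?case
    using one_imp_carrier I_notcarr by simp
next
  case (Suc n)
  then show ?case
    using I_prime[of "a [^] n" a] a by auto
qed

theorem corollary3:
  fixes R :: "('a, 'b) ring_scheme" (structure)
  assumes "cring R" and "star_property R"
  shows "zero_dimensional R"
  unfolding zero_dimensional_def
proof (intro allI impI)
  interpret cring R by fact
  fix P assume "primeideal P R"
  then interpret P: primeideal P R .
  show "maximalideal P R"
  proof (rule maximalidealI)
    show "ideal P R" "carrier R \<noteq> P"
      using P.is_ideal P.I_notcarr by blast+
    fix J assume J: "ideal J R" "P \<subseteq> J" "J \<subseteq> carrier R"
    interpret J: ideal J R by fact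
    show "J = P \<or> J = carrier R"
    proof (cases "J = P")
      case False
      then obtain a where a: "a \<in> J" "a \<notin> P" "a \<in> carrier R"
        using J by blast
      obtain k :: nat and r where r: "r \<in> carrier R" "a [^] k = r \<otimes> a [^] Suc k"
        using star_property_power_eq[OF assms a(3)] .
      have "a [^] k \<otimes> (\<one> \<ominus> r \<otimes> a) = a [^] k \<ominus> r \<otimes> a [^] Suc k"
        using a(3) r(1) by (simp add: minus_eq r_distr r_minus m_ac)
      also have "\<dots> = \<zero>"
        using a(3) r by (metis minus_eq nat_pow_closed r_neg)
      finally have "a [^] k \<otimes> (\<one> \<ominus> r \<otimes> a) \<in> P"
        by simp
      \<comment> \<open>As \<open>a\<close> is outside \<open>P\<close>, so is
        \<open>a [^] k\<close>, and primeness puts the other factor in \<open>P\<close>.\<close>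
      then have "\<one> \<ominus> r \<otimes> a \<in> P"
        using P.I_prime[of "a [^] k" "\<one> \<ominus> r \<otimes> a"] P.nat_pow_mem_imp_mem[OF a(3)] a r(1)
        by (metis minus_closed m_closed nat_pow_closed one_closed)
      then have "(\<one> \<ominus> r \<otimes> a) \<oplus> r \<otimes> a \<in> J"
        using J(2) J.I_l_closed[OF a(1) r(1)] by blast
      moreover have "(\<one> \<ominus> r \<otimes> a) \<oplus> r \<otimes> a = \<one>"
        using a(3) r(1) by (simp add: minus_eq a_assoc l_neg)
      ultimately have "\<one> \<in> J"
        by simp
      then show ?thesis
        using J.one_imp_carrier by blast
    qed simp
  qed
qed

end
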